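(* Let $n=p_1^{m_1}\cdots p_\omega^{m_\omega}$ be a positive integer with distinct primes $p_i$ and exponents $m_i\ge1$ (for $n=1$, $\omega=0$). Let $\Delta(G^H(n))=\max_{v\in V(n)}(\Delta^-(v)+\Delta^+(v))$, where $\Delta^-(v),\Delta^+(v)$ are the in- and out-degrees of $v$ in the Hasse diagram $G^H(n)$. Then $\Delta(G^H(n))=\omega(n)+|\{i: m_i>1\}|$.
   Context: $V(n)$ is the set of positive divisors of $n$; $\omega(n)$ is the number of distinct prime factors of $n$. The Hasse diagram $G^H(n)$ is the directed graph on $V(n)$ whose arcs are the pairs $(a,b)$ with $a,b\in V(n)$, $a<b$, $a\mid b$, such that there is no $c\in V(n)$ with $a<c<b$, $a\mid c$, $c\mid b$. *)

theory Defs
  imports "HOL-Computational_Algebra.Primes" "Graph_Theory.Digraph"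
begin

definition divisors :: "nat \<Rightarrow> nat set" where
  "divisors n = {d. d dvd n}"

definition omega :: "nat \<Rightarrow> nat" where
  "omega n = card (prime_factors n)"

definition hasse_arcs :: "nat \<Rightarrow> (nat \<times> nat) set" where
  "hasse_arcs n = {(a, b). a \<in> divisors n \<and> b \<in> divisors n \<and> a < b \<and> a dvd b \<and>
     \<not> (\<exists>c \<in> divisors n. a < c \<and> c < b \<and> a dvd c \<and> c dvd b)}"

definition hasse_diagram :: "nat \<Rightarrow> (nat, nat \<times> nat) pre_digraph" where
  "hasse_diagram n = \<lparr>verts = divisors n, arcs = hasse_arcs n, tail = fst, head = snd\<rparr>"

(* Max and card give the intended values only when the graph is finite and has a vertex. *)
definition max_degree :: "('a, 'b) pre_digraph \<Rightarrow> nat" where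
  "max_degree G = Max ((\<lambda>v. in_degree G v + out_degree G v) ` verts G)"

lemma digraph_hasse_diagram:
  assumes "n > 0"
  shows "digraph (hasse_diagram n)"
proof -
  have fin: "finite (divisors n)"
    using assms by (simp add: divisors_def)
  have sub: "hasse_arcs n \<subseteq> divisors n \<times> divisors n"
    unfolding hasse_arcs_def by blast
  have "finite (hasse_arcs n)"
    using sub finite_cartesian_product[OF fin fin] by (rule finite_subset)
  moreover have "fst e \<noteq> snd e" if "e \<in> hasse_arcs n" for e
    using that unfolding hasse_arcs_def by auto
  ultimately show ?thesis
    using fin sub by unfold_locales (simp_all add: hasse_diagram_def arc_to_ends_def, auto)
qed

lemma verts_hasse_diagram_nonempty: "verts (hasse_diagram n) \<noteq> {}"
  by (auto simp: hasse_diagram_def divisors_def)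

end

theory Submission
  imports Defs
begin

text \<open>
  The arcs of the Hasse diagram are the pairs \<open>(a, a q)\<close> with \<open>q\<close> prime. So a divisor \<open>v\<close> of \<open>n\<close>
  has in-degree \<open>\<omega>(v)\<close> and out-degree \<open>\<omega>(n / v)\<close>. The primes of \<open>v\<close> and of \<open>n / v\<close> together
  are those of \<open>n\<close>, and a prime occurring in both has its square dividing \<open>n\<close>. By
  inclusion-exclusion the degree of \<open>v\<close> is therefore at most the claimed value, and equality is
  attained at the radical of \<open>n\<close>.
\<close>

text \<open>If \<open>b = a * r\<close> with \<open>r \<noteq> 1\<close>, any prime \<open>q\<close>
  dividing \<open>r\<close> yields the divisor \<open>a * q\<close>, which must be \<open>b\<close>
  since nothing lies strictly between. Conversely, an intermediate \<open>a * s\<close> would make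
  \<open>s\<close> a divisor of a prime other than 1 and itself.\<close>

lemma hasse_arcs_iff:
  assumes "n > 0"
  shows "(a, b) \<in> hasse_arcs n \<longleftrightarrow> b dvd n \<and> (\<exists>q. prime q \<and> b = a * q)"
proof
  assume arc: "(a, b) \<in> hasse_arcs n"
  then have bn: "b dvd n" and ab: "a < b" "a dvd b"
    and between: "\<And>c. c dvd n \<Longrightarrow> a < c \<Longrightarrow> c < b \<Longrightarrow> a dvd c \<Longrightarrow> \<not> c dvd b"
    by (auto simp: hasse_arcs_def divisors_def)
  from ab obtain r where r: "b = a * r"
    by blast
  with ab have "a > 0" "r \<noteq> 1"
    by (auto intro: Nat.gr0I)
  then obtain q where q: "prime q" "q dvd r"
    using prime_factor_nat by blast
  then have "a * q dvd b"
    using r by simp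
  moreover have "a < a * q"
    using \<open>a > 0\<close> prime_gt_1_nat[OF q(1)] by simp
  moreover have "a * q \<le> b"
    using \<open>a * q dvd b\<close> ab by (intro dvd_imp_le) auto
  ultimately have "a * q = b"
    using between[of "a * q"] dvd_trans[OF _ bn] by (cases "a * q < b") auto
  with q bn show "b dvd n \<and> (\<exists>q. prime q \<and> b = a * q)"
    by auto
next
  assume "b dvd n \<and> (\<exists>q. prime q \<and> b = a * q)"
  then obtain q where bn: "b dvd n" and q: "prime q" and b: "b = a * q"
    by blast
  have "a > 0"
    using bn b assms by (auto intro: Nat.gr0I)
  have False if "a < c" "c < b" "a dvd c" "c dvd b" for c
  proof -
    obtain s where s: "c = a * s"
      using \<open>a dvd c\<close> by blast
    then have "s dvd q"
      using that b \<open>a > 0\<close> by simp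
    then have "s = 1 \<or> s = q"
      using q by (simp add: prime_nat_iff)
    then show False
      using that s b by auto
  qed
  moreover have "a < b"
    using b \<open>a > 0\<close> prime_gt_1_nat[OF q] by simp
  moreover have "a dvd n"
    using bn b dvd_mult_left by blast
  ultimately show "(a, b) \<in> hasse_arcs n"
    using bn b by (auto simp: hasse_arcs_def divisors_def)
qed

lemma in_degree_hasse_diagram:
  assumes "n > 0" and "v dvd n"
  shows "in_degree (hasse_diagram n) v = card (prime_factors v)"
proof -
  have "v > 0"
    using assms by (auto intro: Nat.gr0I)
  have "in_arcs (hasse_diagram n) v = (\<lambda>q. (v div q, v)) ` prime_factors v"
  proof (intro set_eqI iffI)
    fix e assume "e \<in> in_arcs (hasse_diagram n) v"
    then obtain a q where "e = (a, v)" "prime q" "v = a * q"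
      using hasse_arcs_iff[OF assms(1)] by (cases e) (auto simp: hasse_diagram_def)
    then show "e \<in> (\<lambda>q. (v div q, v)) ` prime_factors v"
      using \<open>v > 0\<close> by (auto simp: prime_factors_dvd prime_gt_0_nat intro!: image_eqI[of _ _ q])
  next
    fix e assume "e \<in> (\<lambda>q. (v div q, v)) ` prime_factors v"
    then obtain q where q: "e = (v div q, v)" "prime q" "q dvd v"
      by auto
    then have "v = v div q * q"
      by simp
    with q show "e \<in> in_arcs (hasse_diagram n) v"
      using hasse_arcs_iff[OF assms(1), of "v div q" v] assms(2)
      by (auto simp: hasse_diagram_def)
  qed
  \<comment> \<open>The prime is recovered as the quotient of head by tail.\<close>
  moreover have "inj_on (\<lambda>q. (v div q, v)) (prime_factors v)"
    using \<open>v > 0\<close>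
    by (intro inj_on_inverseI[where g = "\<lambda>(a, b). b div a"]) (auto simp: prime_factors_dvd elim!: dvdE)
  ultimately show ?thesis
    by (simp add: in_degree_def card_image)
qed

text \<open>With \<open>n = v * w\<close>, the head \<open>v * q\<close> divides \<open>n\<close>
  exactly when \<open>q\<close> divides \<open>w\<close>.\<close>

lemma out_degree_hasse_diagram:
  assumes "n > 0" and "v dvd n"
  shows "out_degree (hasse_diagram n) v = card (prime_factors (n div v))"
proof -
  obtain w where w: "n = v * w"
    using assms by blast
  then have "v > 0" "w > 0"
    using assms by auto
  have "out_arcs (hasse_diagram n) v = (\<lambda>q. (v, v * q)) ` prime_factors w"
    using \<open>v > 0\<close> \<open>w > 0\<close> hasse_arcs_iff[OF assms(1)]
    by (auto simp: out_arcs_def hasse_diagram_def prime_factors_dvd w)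
  moreover have "inj_on (\<lambda>q. (v, v * q)) (prime_factors w)"
    using \<open>v > 0\<close> by (auto intro!: inj_onI)
  ultimately show ?thesis
    using w \<open>v > 0\<close> by (simp add: out_degree_def card_image)
qed

text \<open>Since \<open>omega n\<close> does not depend on \<open>v\<close>, maximizing the degree
  becomes maximizing the number of primes shared by \<open>v\<close> and
  \<open>n div v\<close>.\<close>

lemma degree_hasse_diagram:
  assumes "n > 0" and "v dvd n"
  shows "in_degree (hasse_diagram n) v + out_degree (hasse_diagram n) v =
    omega n + card (prime_factors v \<inter> prime_factors (n div v))"
proof -
  have "prime_factors n = prime_factors v \<union> prime_factors (n div v)"
    using assms prime_factors_product[of v "n div v"] by (auto simp: dvd_div_eq_0_iff)
  then show ?thesis
    using assms card_Un_Int[of "prime_factors v" "prime_factors (n div v)"]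
    by (simp add: in_degree_hasse_diagram out_degree_hasse_diagram omega_def)
qed

lemma common_prime_factors_subset:
  fixes n v :: nat
  assumes "n > 0" and "v dvd n"
  shows "prime_factors v \<inter> prime_factors (n div v) \<subseteq> {q. prime q \<and> q\<^sup>2 dvd n}"
proof
  fix q assume q: "q \<in> prime_factors v \<inter> prime_factors (n div v)"
  then have "q * q dvd v * (n div v)"
    by (intro mult_dvd_mono) auto
  then show "q \<in> {q. prime q \<and> q\<^sup>2 dvd n}"
    using q assms by (auto simp: power2_eq_square)
qed

text \<open>Distinct primes are coprime, so their divisibilities multiply. This serves both the
  radical and the radical with one prime removed.\<close>

lemma prod_primes_dvd:
  fixes n :: nat
  assumes "finite A" and "\<And>q. q \<in> A \<Longrightarrow> prime q" and "\<And>q. q \<in> A \<Longrightarrow> q dvd n"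
  shows "\<Prod>A dvd n"
  using assms
proof (induction A)
  case (insert q A)
  then have "coprime q (\<Prod>A)"
    by (intro prod_coprime_right) (metis insertCI primes_coprime)
  with insert show ?case
    by (simp add: divides_mult)
qed simp

lemma common_prime_factors_radical:
  fixes n :: nat
  assumes "n > 0"
  defines "v \<equiv> \<Prod>(prime_factors n)"
  shows "v dvd n" and "prime_factors v \<inter> prime_factors (n div v) = {q. prime q \<and> q\<^sup>2 dvd n}"
proof -
  show "v dvd n"
    unfolding v_def by (rule prod_primes_dvd) auto
  have "q dvd v \<and> q dvd n div v" if q: "prime q" and sq: "q\<^sup>2 dvd n" for q
  proof -
    \<comment> \<open>Here \<open>v = q * r\<close>. As \<open>q\<^sup>2\<close> and
      \<open>r\<close> are coprime divisors of \<open>n\<close>, their product \<open>v * q\<close>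
      divides \<open>n\<close>, so one factor \<open>q\<close> survives in
      \<open>n div v\<close>.\<close>
    define r where "r = \<Prod>(prime_factors n - {q})"
    have "q dvd n"
      using sq by (auto simp: power2_eq_square dest: dvd_mult_left)
    then have v: "v = q * r"
      unfolding v_def r_def using q assms
      by (intro prod.remove[where g = "\<lambda>x. x", simplified]) (auto simp: prime_factors_dvd)
    have "r dvd n"
      unfolding r_def by (rule prod_primes_dvd) auto
    moreover have "coprime q r"
      unfolding r_def using q
      by (intro prod_coprime_right) (metis DiffE in_prime_factors_imp_prime insertI1 primes_coprime)
    ultimately have "v * q dvd n"
      using sq divides_mult[of "q\<^sup>2" n r] by (simp add: v power2_eq_square mult_ac)
    then show ?thesis
      using v \<open>v dvd n\<close> assms by (auto simp: dvd_div_iff_mult mult.commute)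
  qed
  then show "prime_factors v \<inter> prime_factors (n div v) = {q. prime q \<and> q\<^sup>2 dvd n}"
    using common_prime_factors_subset[OF assms(1) \<open>v dvd n\<close>] \<open>v dvd n\<close> assms(1)
    by (auto simp: prime_factors_dvd dvd_div_eq_0_iff)
qed

text \<open>Counting primes whose square divides \<open>n\<close> keeps the argument independent of
  any chosen factorization.\<close>

lemma max_degree_hasse_diagram:
  assumes "n > 0"
  shows "max_degree (hasse_diagram n) = omega n + card {q. prime q \<and> q\<^sup>2 dvd n}"
  unfolding max_degree_def
proof (rule Max_eqI)
  show "finite ((\<lambda>v. in_degree (hasse_diagram n) v + out_degree (hasse_diagram n) v) ` verts (hasse_diagram n))"
    using assms by (simp add: hasse_diagram_def divisors_def)
  have "{q. prime q \<and> q\<^sup>2 dvd n} \<subseteq> prime_factors n"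
    using assms by (auto simp: prime_factors_dvd power2_eq_square dest: dvd_mult_left)
  then have fin: "finite {q. prime q \<and> q\<^sup>2 dvd n}"
    by (rule finite_subset) simp
  \<comment> \<open>Only \<open>verts\<close> of the diagram is unfolded; the degrees stay folded so
    that \<open>degree_hasse_diagram\<close> can rewrite them.\<close>
  show "d \<le> omega n + card {q. prime q \<and> q\<^sup>2 dvd n}"
    if "d \<in> (\<lambda>v. in_degree (hasse_diagram n) v + out_degree (hasse_diagram n) v) ` verts (hasse_diagram n)" for d
    using that assms card_mono[OF fin common_prime_factors_subset]
    by (auto simp: hasse_diagram_def[THEN arg_cong[of _ _ verts]] divisors_def degree_hasse_diagram)
  show "omega n + card {q. prime q \<and> q\<^sup>2 dvd n} \<in>
      (\<lambda>v. in_degree (hasse_diagram n) v + out_degree (hasse_diagram n) v) ` verts (hasse_diagram n)"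
    using common_prime_factors_radical[OF assms] degree_hasse_diagram[OF assms]
    by (intro image_eqI[of _ _ "\<Prod>(prime_factors n)"])
       (simp_all add: hasse_diagram_def[THEN arg_cong[of _ _ verts]] divisors_def)
qed

theorem theorem7:
  fixes n k :: nat and p m :: "nat \<Rightarrow> nat"
  assumes "n > 0"
    and "\<And>i. i \<in> {1..k} \<Longrightarrow> prime (p i)"
    and "inj_on p {1..k}"
    and "\<And>i. i \<in> {1..k} \<Longrightarrow> m i \<ge> 1"
    and "n = (\<Prod>i = 1..k. p i ^ m i)"
  shows "max_degree (hasse_diagram n) = omega n + card {i \<in> {1..k}. m i > 1}"
proof -
  \<comment> \<open>Exponents are moved from indices to primes, so that \<open>n\<close> becomes a
    product over a set of primes and its multiplicities can be read off.\<close>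
  define e where "e = (\<lambda>q. m (the_inv_into {1..k} p q))"
  have e: "e (p i) = m i" if "i \<in> {1..k}" for i
    using that assms(3) by (simp add: e_def the_inv_into_f_f)
  have n: "n = (\<Prod>q\<in>p ` {1..k}. q ^ e q)"
    using assms(3) e unfolding assms(5) by (simp add: prod.reindex)
  have mult: "multiplicity q n = (if q \<in> p ` {1..k} then e q else 0)" if "prime q" for q
    unfolding n using that assms(2) by (intro multiplicity_prod_prime_powers) auto
  \<comment> \<open>For a prime \<open>q\<close>, \<open>q\<^sup>2 dvd n\<close> means multiplicity
    at least 2. Multiplicity is 0 outside the image of \<open>p\<close>, so such a \<open>q\<close>
    is some \<open>p i\<close>.\<close>
  have "{q. prime q \<and> q\<^sup>2 dvd n} = p ` {i \<in> {1..k}. m i > 1}"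
  proof (intro set_eqI iffI)
    fix q assume "q \<in> {q. prime q \<and> q\<^sup>2 dvd n}"
    then have "prime q" "multiplicity q n \<ge> 2"
      using assms(1) by (auto intro!: multiplicity_geI)
    then show "q \<in> p ` {i \<in> {1..k}. m i > 1}"
      using mult[of q] e by (auto split: if_splits)
  next
    fix q assume "q \<in> p ` {i \<in> {1..k}. m i > 1}"
    then obtain i where i: "i \<in> {1..k}" "m i > 1" "q = p i"
      by blast
    then have "prime q" "multiplicity q n \<ge> 2"
      using assms(2) mult[of q] e by auto
    then show "q \<in> {q. prime q \<and> q\<^sup>2 dvd n}"
      by (auto intro: multiplicity_dvd')
  qed
  \<comment> \<open>Injectivity turns the count of primes into a count of indices.\<close>
  moreover have "inj_on p {i \<in> {1..k}. m i > 1}"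
    using assms(3) by (rule inj_on_subset) auto
  ultimately show ?thesis
    by (simp add: max_degree_hasse_diagram[OF assms(1)] card_image)
qed

end
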